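(* Let $\alpha\in(0,1)$, $\beta\in(0,1-\alpha)$. For the testing problem $H_0:\pi=\pi_0$ versus $H_1:W_1(\pi,\pi_0)\ge\epsilon$ based on $X_1,\dots,X_n$ i.i.d. from $P_\pi$, where $\pi_0\in D$ is an arbitrary known distribution on $[0,1]$, consider the plug-in test $$\psi(X)=I\big(\hat W_1(X)>q_\alpha(P_{\pi_0},\hat W_1)\big),\qquad \hat W_1(X)=W_1(\hat\pi,\pi_0),\qquad \hat\pi=\frac1n\sum_{i=1}^n\delta_{X_i/t}.$$ Then $P_{\pi_0}^n(\psi(X)=1)\le\alpha$. Moreover, there exists a positive constant $C$ (depending only on $\alpha,\beta$; in particular not on $n,t,\pi_0$) such that $\sup_{\pi\in D:\,W_1(\pi,\pi_0)\ge\epsilon}P_\pi^n(\psi(X)=0)\le\beta$ whenever $$\epsilon\ \ge\ C\left[\frac{J(\pi_0)}{\sqrt n}+\sqrt{\frac{E_{p\sim\pi_0}[p(1-p)]}{t}}+\frac1n+\frac1t\right].$$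
   Context: $n,t\ge1$ are integers. $D$ is the set of all probability distributions on $[0,1]$. For $\pi\in D$, $P_\pi$ is the binomial mixture on $\{0,\dots,t\}$: $P_\pi(\{j\})=E_{p\sim\pi}\big[\binom tj p^j(1-p)^{t-j}\big]$; $P_\pi^n$ is its $n$-fold product and $X=(X_1,\dots,X_n)\sim P_\pi^n$. $W_1$ is the 1-Wasserstein distance on $[0,1]$ with cost $|p-q|$. $I(\cdot)$ is the indicator. For a statistic $T$ of the sample, $q_\alpha(P_{\pi_0},T)=\inf\{u: P_{\pi_0}^n(T(X)>u)\le\alpha\}$ is its $1-\alpha$ quantile under $P_{\pi_0}^n$. $J(\pi)=\int_0^1\sqrt{F_\pi(x)(1-F_\pi(x))}\,dx$, where $F_\pi$ is the cumulative distribution function of $\pi$. *)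

theory Defs
  imports "HOL-Probability.Probability"
begin

text \<open>A probability distribution on \<open>[0,1]\<close> is a Borel probability measure on the real line that is
  concentrated on \<open>[0,1]\<close>.\<close>

definition unit_distributions :: "real measure set" where
  "unit_distributions = {\<pi>. prob_space \<pi> \<and> sets \<pi> = sets borel \<and> measure \<pi> {0..1} = 1}"

definition binomial_mixture :: "nat \<Rightarrow> real measure \<Rightarrow> nat measure" where
  "binomial_mixture t \<pi> =
     point_measure {0..t} (\<lambda>j. ennreal (\<integral>p. real (t choose j) * p ^ j * (1 - p) ^ (t - j) \<partial>\<pi>))"

definition sample_distribution :: "nat \<Rightarrow> nat \<Rightarrow> real measure \<Rightarrow> (nat \<Rightarrow> nat) measure" where
  "sample_distribution n t \<pi> = (\<Pi>\<^sub>M i\<in>{1..n}. binomial_mixture t \<pi>)"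

definition couplings :: "real measure \<Rightarrow> real measure \<Rightarrow> (real \<times> real) measure set" where
  "couplings \<mu> \<nu> = {\<gamma>. prob_space \<gamma> \<and> sets \<gamma> = sets (borel \<Otimes>\<^sub>M borel) \<and>
     distr \<gamma> borel fst = \<mu> \<and> distr \<gamma> borel snd = \<nu>}"

text \<open>For arguments in \<^const>\<open>unit_distributions\<close> every coupling is concentrated on the unit square,
  so the cost is bounded and each integral below is finite.\<close>

definition W1 :: "real measure \<Rightarrow> real measure \<Rightarrow> real" where
  "W1 \<mu> \<nu> = (INF \<gamma>\<in>couplings \<mu> \<nu>. \<integral>z. \<bar>fst z - snd z\<bar> \<partial>\<gamma>)"

text \<open>The mixture \<open>(1/n) \<Sum>\<^sub>i \<delta>(x\<^sub>i/t)\<close> of point masses is the law of \<open>x\<^sub>i/t\<close> for an index \<open>i\<close>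
  drawn uniformly from \<open>{1..n}\<close>.\<close>

definition empirical_distribution :: "nat \<Rightarrow> nat \<Rightarrow> (nat \<Rightarrow> nat) \<Rightarrow> real measure" where
  "empirical_distribution n t x =
     distr (uniform_count_measure {1..n}) borel (\<lambda>i. real (x i) / real t)"

definition W1_hat :: "nat \<Rightarrow> nat \<Rightarrow> real measure \<Rightarrow> (nat \<Rightarrow> nat) \<Rightarrow> real" where
  "W1_hat n t \<pi>\<^sub>0 x = W1 (empirical_distribution n t x) \<pi>\<^sub>0"

definition null_quantile ::
  "real \<Rightarrow> nat \<Rightarrow> nat \<Rightarrow> real measure \<Rightarrow> ((nat \<Rightarrow> nat) \<Rightarrow> real) \<Rightarrow> real" where
  "null_quantile \<alpha> n t \<pi>\<^sub>0 T =
     Inf {u. measure (sample_distribution n t \<pi>\<^sub>0)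
               {x \<in> space (sample_distribution n t \<pi>\<^sub>0). T x > u} \<le> \<alpha>}"

definition plugin_test :: "real \<Rightarrow> nat \<Rightarrow> nat \<Rightarrow> real measure \<Rightarrow> (nat \<Rightarrow> nat) \<Rightarrow> nat" where
  "plugin_test \<alpha> n t \<pi>\<^sub>0 x =
     of_bool (W1_hat n t \<pi>\<^sub>0 x > null_quantile \<alpha> n t \<pi>\<^sub>0 (W1_hat n t \<pi>\<^sub>0))"

definition J_functional :: "real measure \<Rightarrow> real" where
  "J_functional \<pi> = (LBINT x:{0..1}. sqrt (cdf \<pi> x * (1 - cdf \<pi> x)))"

end

theory Submission
  imports Defs
begin

text \<open>The level of the test holds because the infimum defining the quantile is attained: the sample
  space is finite, so the statistic takes no value just above its quantile
  (\<open>upper_tail_quantile_le\<close>).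

  For the power, \<open>W1\<close> on the line is the \<open>L\<^sup>1\<close> distance of the cumulative distribution functions
  (\<open>W1_eq_cdf_distance\<close>): every coupling costs at least that much, and the quantile coupling attains
  it. In this form the triangle inequality is immediate. Let \<open>\<mu>\<close> be the law of \<open>X / t\<close> for one
  observation. The distance from \<open>\<mu>\<close> to \<open>\<pi>\<close> is at most \<open>sqrt (E (p (1 - p)) / t)\<close>
  (\<open>cdf_distance_proportion_distribution\<close>), and the expected distance from the empirical
  distribution to \<open>\<mu>\<close> is at most \<open>J \<mu> / sqrt n\<close>, because the empirical distribution function has
  variance \<open>F (1 - F) / n\<close> at each point (\<open>expected_cdf_distance_empirical_proportion\<close>).

  These bounds involve \<open>J\<close> and \<open>E (p (1 - p))\<close> at the true distribution, whereas the separation rate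
  involves them at \<open>\<pi>\<^sub>0\<close>. What makes them comparable is that
  \<open>sqrt (F (1 - F)) \<le> sqrt (G (1 - G)) + sqrt \<bar>F - G\<bar>\<close> and that \<open>p (1 - p)\<close> is 1-Lipschitz. With
  the inequality \<open>sqrt (v / m) \<le> c v + 1 / (4 c m)\<close>, a change of distribution by distance \<open>w\<close> costs
  only a small multiple of \<open>w\<close> plus terms of order \<open>1 / n\<close> and \<open>1 / t\<close>
  (\<open>J_functional_perturbation\<close>, \<open>bernoulli_variance_expectation_le\<close>). Under an alternative at
  distance \<open>w\<close>, the expected distance from the empirical distribution to \<open>\<pi>\<close> is therefore a small
  fraction of \<open>w\<close>. Markov's inequality under \<open>\<pi>\<^sub>0\<close> bounds the quantile by \<open>w / 2\<close>, and under \<open>\<pi>\<close> it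
  bounds the probability that the empirical distribution is at distance \<open>w / 2\<close> or more from \<open>\<pi>\<close>,
  as it must be for the test to accept.\<close>

section \<open>Probability distributions on the unit interval\<close>

lemma unit_distributionsD:
  assumes "\<pi> \<in> unit_distributions"
  shows "real_distribution \<pi>" "prob_space \<pi>" "sets \<pi> = sets borel" "space \<pi> = UNIV"
    "AE x in \<pi>. x \<in> {0..1}"
proof -
  show 1: "prob_space \<pi>" and 2: "sets \<pi> = sets borel"
    using assms by (auto simp: unit_distributions_def)
  interpret prob_space \<pi> by fact
  show 3: "space \<pi> = UNIV"
    using sets_eq_imp_space_eq[OF 2] by simp
  show "real_distribution \<pi>"
    unfolding real_distribution_def real_distribution_axioms_def using 1 2 3 by simp
  show "AE x in \<pi>. x \<in> {0..1}"
    using assms 2 by (intro AE_prob_1) (auto simp: unit_distributions_def)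
qed

lemma unit_distributionsI:
  assumes "prob_space \<pi>" "sets \<pi> = sets borel" "AE x in \<pi>. x \<in> {0..1}"
  shows "\<pi> \<in> unit_distributions"
proof -
  interpret prob_space \<pi> by fact
  have "{0..1} \<in> events" using assms(2) by simp
  then have "prob {0..1} = 1"
    using prob_eq_1[of "{0..1}"] assms(3) by auto
  then show ?thesis using assms by (simp add: unit_distributions_def)
qed

text \<open>The uniform distribution on \<open>[0,1]\<close>. As a density on the whole line it keeps the Borel
  sigma algebra, so that Borel functions need no restriction before they are integrated.\<close>

definition unit_uniform :: "real measure" where
  "unit_uniform = density lborel (indicator {0..1})"

lemma sets_unit_uniform [simp, measurable_cong]: "sets unit_uniform = sets borel"
  by (simp add: unit_uniform_def)

lemma space_unit_uniform [simp]: "space unit_uniform = UNIV"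
  by (simp add: unit_uniform_def)

lemma prob_space_unit_uniform: "prob_space unit_uniform"
  by (rule prob_spaceI) (simp add: unit_uniform_def emeasure_density)

interpretation U: prob_space unit_uniform
  by (rule prob_space_unit_uniform)

lemma integral_unit_uniform:
  fixes f :: "real \<Rightarrow> real"
  assumes [measurable]: "f \<in> borel_measurable borel"
  shows "(\<integral>s. f s \<partial>unit_uniform) = (LBINT s:{0..1}. f s)"
proof -
  have eq: "unit_uniform = density lborel (\<lambda>x. ennreal (indicator {0..1} x))"
    by (simp add: unit_uniform_def ennreal_indicator)
  show ?thesis
    unfolding eq set_lebesgue_integral_def by (subst integral_density) auto
qed

section \<open>The Wasserstein distance on the line\<close>

text \<open>A level \<open>s\<close> separates \<open>x\<close> from \<open>y\<close> exactly if it lies between them, so \<open>\<bar>x - y\<bar>\<close> is the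
  length of the set of separating levels.\<close>

lemma integral_separating_levels:
  assumes "x \<in> {0..1}" "y \<in> {0..1}"
  shows "(\<integral>s. \<bar>indicator {..s} x - indicator {..s} y\<bar> \<partial>unit_uniform) = \<bar>x - y :: real\<bar>"
proof -
  have *: "(\<integral>s. \<bar>indicator {..s} x - indicator {..s} y :: real\<bar> \<partial>unit_uniform) = y - x"
    if "0 \<le> x" "x \<le> y" "y \<le> 1" for x y :: real
  proof -
    have "(\<integral>s. \<bar>indicator {..s} x - indicator {..s} y :: real\<bar> \<partial>unit_uniform)
        = (\<integral>s. indicator {x..<y} s \<partial>unit_uniform)"
      using that by (intro Bochner_Integration.integral_cong) (auto simp: indicator_def)
    also have "\<dots> = (LBINT s:{0..1}. indicator {x..<y} s)"
      by (rule integral_unit_uniform) simp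
    also have "\<dots> = (\<integral>s. indicator {x..<y} s \<partial>lborel)"
      unfolding set_lebesgue_integral_def using that
      by (intro Bochner_Integration.integral_cong) (auto simp: indicator_def)
    also have "\<dots> = y - x" using that by simp
    finally show ?thesis .
  qed
  show ?thesis
    using *[of x y] *[of y x] assms
    by (cases "x \<le> y") (auto simp: abs_minus_commute)
qed

text \<open>The same identity for the levels \<open>u\<close> of the quantile functions, which live on the open
  interval because quantile functions may be undefined at \<open>0\<close> and \<open>1\<close>.\<close>

lemma integral_separating_quantile_levels:
  assumes "a \<in> {0..1}" "b \<in> {0..1}"
  shows "(\<integral>u. \<bar>indicator {u..} a - indicator {u..} b\<bar> \<partial>restrict_space lborel {0<..<1}) = \<bar>a - b :: real\<bar>"
proof -
  have *: "(\<integral>u. \<bar>indicator {u..} a - indicator {u..} b :: real\<bar> \<partial>restrict_space lborel {0<..<1}) = b - a"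
    if "0 \<le> a" "a \<le> b" "b \<le> 1" for a b :: real
  proof -
    have "(\<integral>u. \<bar>indicator {u..} a - indicator {u..} b :: real\<bar> \<partial>restrict_space lborel {0<..<1})
        = (LBINT u:{0<..<1}. \<bar>indicator {u..} a - indicator {u..} b :: real\<bar>)"
      unfolding set_lebesgue_integral_def by (subst integral_restrict_space) auto
    also have "\<dots> = (\<integral>s. indicator {a<..b} s \<partial>lborel)"
      unfolding set_lebesgue_integral_def
      by (rule integral_cong_AE, measurable)
         (use AE_lborel_singleton[of 1] that in \<open>auto simp: indicator_def\<close>)
    also have "\<dots> = b - a" using that by simp
    finally show ?thesis .
  qed
  show ?thesis
    using *[of a b] *[of b a] assms
    by (cases "a \<le> b") (auto simp: abs_minus_commute)
qed

text \<open>The \<open>L\<^sup>1\<close> distance on \<open>[0,1]\<close> of the cumulative distribution functions.\<close>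

definition cdf_distance :: "real measure \<Rightarrow> real measure \<Rightarrow> real" where
  "cdf_distance \<mu> \<nu> = (\<integral>s. \<bar>cdf \<mu> s - cdf \<nu> s\<bar> \<partial>unit_uniform)"

lemma cdf_unit_distribution:
  assumes "\<mu> \<in> unit_distributions"
  shows "cdf \<mu> \<in> borel_measurable borel" "0 \<le> cdf \<mu> s" "cdf \<mu> s \<le> 1"
proof -
  interpret cdf_distribution \<mu>
    using assms by (simp add: cdf_distribution_def unit_distributionsD)
  show "cdf \<mu> \<in> borel_measurable borel" "0 \<le> cdf \<mu> s" "cdf \<mu> s \<le> 1"
    by (auto simp: cdf_nonneg cdf_bounded_prob)
qed

lemma integrable_cdf_distance:
  assumes "\<mu> \<in> unit_distributions" "\<nu> \<in> unit_distributions"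
  shows "integrable unit_uniform (\<lambda>s. \<bar>cdf \<mu> s - cdf \<nu> s\<bar>)"
proof (rule U.integrable_const_bound)
  note [measurable] = cdf_unit_distribution(1)[OF assms(1)] cdf_unit_distribution(1)[OF assms(2)]
  show "(\<lambda>s. \<bar>cdf \<mu> s - cdf \<nu> s\<bar>) \<in> borel_measurable unit_uniform" by measurable
  show "AE s in unit_uniform. norm \<bar>cdf \<mu> s - cdf \<nu> s\<bar> \<le> 1"
    using cdf_unit_distribution(2,3)[OF assms(1)] cdf_unit_distribution(2,3)[OF assms(2)] 
    by (intro AE_I2) (auto simp: abs_le_iff, (smt (verit))+)
qed

lemma cdf_distance_nonneg: "0 \<le> cdf_distance \<mu> \<nu>"
  unfolding cdf_distance_def by simp

lemma cdf_distance_commute: "cdf_distance \<mu> \<nu> = cdf_distance \<nu> \<mu>"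
  unfolding cdf_distance_def by (simp add: abs_minus_commute)

lemma cdf_distance_triangle:
  assumes "\<mu> \<in> unit_distributions" "\<nu> \<in> unit_distributions" "\<rho> \<in> unit_distributions"
  shows "cdf_distance \<mu> \<rho> \<le> cdf_distance \<mu> \<nu> + cdf_distance \<nu> \<rho>"
  unfolding cdf_distance_def
  by (subst Bochner_Integration.integral_add[symmetric])
     (auto intro!: integral_mono integrable_cdf_distance Bochner_Integration.integrable_add assms)

lemma cdf_distr:
  assumes "prob_space M" "X \<in> borel_measurable M"
  shows "cdf (distr M borel X) s = (\<integral>\<omega>. indicator {..s} (X \<omega>) \<partial>M)"
proof -
  interpret prob_space M by fact
  have "cdf (distr M borel X) s = (\<integral>x. indicator {..s} x \<partial>distr M borel X)"
    by (simp add: cdf_def)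
  also have "\<dots> = (\<integral>\<omega>. indicator {..s} (X \<omega>) \<partial>M)"
    using assms(2) by (subst integral_distr) auto
  finally show ?thesis .
qed

text \<open>By \<open>integral_separating_levels\<close> and Fubini, the expected distance of two random variables
  with values in \<open>[0,1]\<close> is the integral over all levels \<open>s\<close> of the probability that \<open>s\<close> separates them.\<close>

lemma expectation_abs_diff:
  fixes X Y :: "'a \<Rightarrow> real"
  assumes "prob_space M" and [measurable]: "X \<in> borel_measurable M" "Y \<in> borel_measurable M"
    and "AE \<omega> in M. X \<omega> \<in> {0..1}" "AE \<omega> in M. Y \<omega> \<in> {0..1}"
  shows "(\<integral>\<omega>. \<bar>X \<omega> - Y \<omega>\<bar> \<partial>M)
    = (\<integral>s. (\<integral>\<omega>. \<bar>indicator {..s} (X \<omega>) - indicator {..s} (Y \<omega>)\<bar> \<partial>M) \<partial>unit_uniform)"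
proof -
  interpret M: prob_space M by fact
  interpret P: pair_prob_space M unit_uniform ..
  have "(\<lambda>p. \<bar>indicator {..snd p} (X (fst p)) - indicator {..snd p} (Y (fst p)) :: real\<bar>)
      \<in> borel_measurable (M \<Otimes>\<^sub>M unit_uniform)"
    unfolding indicator_def atMost_iff by measurable
  then have "integrable (M \<Otimes>\<^sub>M unit_uniform)
      (\<lambda>(\<omega>, s). \<bar>indicator {..s} (X \<omega>) - indicator {..s} (Y \<omega>) :: real\<bar>)"
    by (intro P.integrable_const_bound[where B = 1])
       (auto simp: indicator_def case_prod_beta)
  from P.Fubini_integral[OF this]
  have "(\<integral>s. (\<integral>\<omega>. \<bar>indicator {..s} (X \<omega>) - indicator {..s} (Y \<omega>) :: real\<bar> \<partial>M) \<partial>unit_uniform)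
      = (\<integral>\<omega>. (\<integral>s. \<bar>indicator {..s} (X \<omega>) - indicator {..s} (Y \<omega>) :: real\<bar> \<partial>unit_uniform) \<partial>M)" .
  also have "\<dots> = (\<integral>\<omega>. \<bar>X \<omega> - Y \<omega>\<bar> \<partial>M)"
  proof (rule integral_cong_AE)
    show "AE \<omega> in M. (\<integral>s. \<bar>indicator {..s} (X \<omega>) - indicator {..s} (Y \<omega>)\<bar> \<partial>unit_uniform) = \<bar>X \<omega> - Y \<omega>\<bar>"
      using assms(4,5) by eventually_elim (rule integral_separating_levels)
    show "(\<lambda>\<omega>. \<integral>s. \<bar>indicator {..s} (X \<omega>) - indicator {..s} (Y \<omega>) :: real\<bar> \<partial>unit_uniform) \<in> borel_measurable M"
      unfolding indicator_def atMost_iff by measurable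
  qed simp
  finally show ?thesis ..
qed

lemma cdf_distance_le_expectation:
  fixes X Y :: "'a \<Rightarrow> real"
  assumes "prob_space M" and [measurable]: "X \<in> borel_measurable M" "Y \<in> borel_measurable M"
    and "AE \<omega> in M. X \<omega> \<in> {0..1}" "AE \<omega> in M. Y \<omega> \<in> {0..1}"
  shows "cdf_distance (distr M borel X) (distr M borel Y) \<le> (\<integral>\<omega>. \<bar>X \<omega> - Y \<omega>\<bar> \<partial>M)"
proof -
  interpret M: prob_space M by fact
  have i: "integrable M (\<lambda>\<omega>. indicator {..s} (X \<omega>) :: real)"
    "integrable M (\<lambda>\<omega>. indicator {..s} (Y \<omega>) :: real)" for s
    by (auto intro!: M.integrable_const_bound[where B = 1] simp: indicator_def)
  have le1: "(\<integral>\<omega>. \<bar>indicator {..s} (X \<omega>) - indicator {..s} (Y \<omega>) :: real\<bar> \<partial>M) \<le> 1" for s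
    using i by (intro M.integral_le_const) (auto simp: indicator_def)
  have "cdf_distance (distr M borel X) (distr M borel Y)
      \<le> (\<integral>s. (\<integral>\<omega>. \<bar>indicator {..s} (X \<omega>) - indicator {..s} (Y \<omega>)\<bar> \<partial>M) \<partial>unit_uniform)"
    unfolding cdf_distance_def
  proof (rule integral_mono')
    show "integrable unit_uniform (\<lambda>s. \<integral>\<omega>. \<bar>indicator {..s} (X \<omega>) - indicator {..s} (Y \<omega>) :: real\<bar> \<partial>M)"
    proof (rule U.integrable_const_bound)
      show "AE s in unit_uniform. norm (\<integral>\<omega>. \<bar>indicator {..s} (X \<omega>) - indicator {..s} (Y \<omega>) :: real\<bar> \<partial>M) \<le> 1"
        using le1 by simp
      show "(\<lambda>s. \<integral>\<omega>. \<bar>indicator {..s} (X \<omega>) - indicator {..s} (Y \<omega>) :: real\<bar> \<partial>M) \<in> borel_measurable unit_uniform"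
        unfolding indicator_def atMost_iff by measurable
    qed
    fix s
    have "cdf (distr M borel X) s - cdf (distr M borel Y) s
        = (\<integral>\<omega>. indicator {..s} (X \<omega>) - indicator {..s} (Y \<omega>) \<partial>M)"
      using i assms by (simp add: cdf_distr)
    then show "\<bar>cdf (distr M borel X) s - cdf (distr M borel Y) s\<bar>
        \<le> (\<integral>\<omega>. \<bar>indicator {..s} (X \<omega>) - indicator {..s} (Y \<omega>)\<bar> \<partial>M)"
      by (metis (no_types) integral_abs_bound)
  qed simp
  also have "\<dots> = (\<integral>\<omega>. \<bar>X \<omega> - Y \<omega>\<bar> \<partial>M)"
    by (rule expectation_abs_diff[symmetric]) (use assms in auto)
  finally show ?thesis .
qed

lemma coupling_marginals:
  assumes "\<gamma> \<in> couplings \<mu> \<nu>" "\<mu> \<in> unit_distributions" "\<nu> \<in> unit_distributions"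
  shows "prob_space \<gamma>" "fst \<in> borel_measurable \<gamma>" "snd \<in> borel_measurable \<gamma>"
    "distr \<gamma> borel fst = \<mu>" "distr \<gamma> borel snd = \<nu>"
    "AE z in \<gamma>. fst z \<in> {0..1}" "AE z in \<gamma>. snd z \<in> {0..1}"
proof -
  show 1: "prob_space \<gamma>" "distr \<gamma> borel fst = \<mu>" "distr \<gamma> borel snd = \<nu>"
    using assms(1) by (auto simp: couplings_def)
  have [measurable_cong]: "sets \<gamma> = sets (borel \<Otimes>\<^sub>M borel)"
    using assms(1) by (auto simp: couplings_def)
  show 2: "fst \<in> borel_measurable \<gamma>" "snd \<in> borel_measurable \<gamma>"
    by measurable
  show "AE z in \<gamma>. fst z \<in> {0..1}"
    using unit_distributionsD(5)[OF assms(2)] 2 unfolding 1(2)[symmetric]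
    by (subst (asm) AE_distr_iff) auto
  show "AE z in \<gamma>. snd z \<in> {0..1}"
    using unit_distributionsD(5)[OF assms(3)] 2 unfolding 1(3)[symmetric]
    by (subst (asm) AE_distr_iff) auto
qed

text \<open>The quantile coupling: both quantile functions are evaluated at the same uniform variable
  \<open>\<omega>\<close>. Since \<open>X \<omega> \<le> s\<close> is equivalent to \<open>\<omega> \<le> cdf \<mu> s\<close>, the probability that \<open>s\<close> separates
  \<open>X\<close> and \<open>Y\<close> is \<open>\<bar>cdf \<mu> s - cdf \<nu> s\<bar>\<close>.\<close>

lemma exists_optimal_coupling:
  assumes "\<mu> \<in> unit_distributions" "\<nu> \<in> unit_distributions"
  obtains \<gamma> where "\<gamma> \<in> couplings \<mu> \<nu>" "(\<integral>z. \<bar>fst z - snd z\<bar> \<partial>\<gamma>) = cdf_distance \<mu> \<nu>"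
proof -
  interpret \<mu>: cdf_distribution \<mu>
    using assms by (simp add: cdf_distribution_def unit_distributionsD)
  interpret \<nu>: cdf_distribution \<nu>
    using assms by (simp add: cdf_distribution_def unit_distributionsD)
  define \<Omega> :: "real measure" where "\<Omega> = restrict_space lborel {0<..<1}"
  have prob: "prob_space \<Omega>"
    by (auto simp: \<Omega>_def space_restrict_space emeasure_restrict_space intro!: prob_spaceI)
  interpret \<Omega>: prob_space \<Omega> by fact
  have space: "space \<Omega> = {0<..<1}" by (simp add: \<Omega>_def space_restrict_space)
  define X where "X = (\<lambda>\<omega>. Inf {x. \<omega> \<le> cdf \<mu> x})"
  define Y where "Y = (\<lambda>\<omega>. Inf {x. \<omega> \<le> cdf \<nu> x})"
  have sets_\<Omega>: "sets \<Omega> = sets (restrict_space borel {0<..<1})"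
    unfolding \<Omega>_def by (rule sets_restrict_space_cong) simp
  have [measurable]: "X \<in> borel_measurable \<Omega>" "Y \<in> borel_measurable \<Omega>"
    using \<mu>.measurable_CI \<nu>.measurable_CI
    by (simp_all add: X_def Y_def cong: measurable_cong_sets[OF sets_\<Omega> refl])
  have dX: "distr \<Omega> borel X = \<mu>" and dY: "distr \<Omega> borel Y = \<nu>"
    using \<mu>.distr_I_eq_M \<nu>.distr_I_eq_M by (simp_all add: X_def Y_def \<Omega>_def)
  have iX: "\<omega> \<in> space \<Omega> \<Longrightarrow> X \<omega> \<le> s \<longleftrightarrow> \<omega> \<le> cdf \<mu> s" for \<omega> s
    using \<mu>.pseudoinverse[of \<omega> s] by (auto simp: X_def space)
  have iY: "\<omega> \<in> space \<Omega> \<Longrightarrow> Y \<omega> \<le> s \<longleftrightarrow> \<omega> \<le> cdf \<nu> s" for \<omega> s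
    using \<nu>.pseudoinverse[of \<omega> s] by (auto simp: Y_def space)
  have aeX: "AE \<omega> in \<Omega>. X \<omega> \<in> {0..1}"
    using unit_distributionsD(5)[OF assms(1)] unfolding dX[symmetric]
    by (subst (asm) AE_distr_iff) auto
  have aeY: "AE \<omega> in \<Omega>. Y \<omega> \<in> {0..1}"
    using unit_distributionsD(5)[OF assms(2)] unfolding dY[symmetric]
    by (subst (asm) AE_distr_iff) auto
  define \<gamma> where "\<gamma> = distr \<Omega> (borel \<Otimes>\<^sub>M borel) (\<lambda>\<omega>. (X \<omega>, Y \<omega>))"
  have "distr \<gamma> borel fst = \<mu>" "distr \<gamma> borel snd = \<nu>"
    unfolding \<gamma>_def by (simp_all add: distr_distr o_def dX dY)
  moreover have "prob_space \<gamma>"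
    unfolding \<gamma>_def by (rule \<Omega>.prob_space_distr) simp
  ultimately have 1: "\<gamma> \<in> couplings \<mu> \<nu>"
    by (simp add: couplings_def \<gamma>_def)
  have "(\<integral>z. \<bar>fst z - snd z\<bar> \<partial>\<gamma>) = (\<integral>\<omega>. \<bar>X \<omega> - Y \<omega>\<bar> \<partial>\<Omega>)"
    unfolding \<gamma>_def by (subst integral_distr) auto
  also have "\<dots> = (\<integral>s. (\<integral>\<omega>. \<bar>indicator {..s} (X \<omega>) - indicator {..s} (Y \<omega>)\<bar> \<partial>\<Omega>) \<partial>unit_uniform)"
    by (rule expectation_abs_diff) (use prob aeX aeY in auto)
  also have "\<dots> = (\<integral>s. (\<integral>\<omega>. \<bar>indicator {\<omega>..} (cdf \<mu> s) - indicator {\<omega>..} (cdf \<nu> s)\<bar> \<partial>\<Omega>) \<partial>unit_uniform)"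
    by (intro Bochner_Integration.integral_cong refl) (simp add: indicator_def iX iY)
  also have "\<dots> = cdf_distance \<mu> \<nu>"
    unfolding cdf_distance_def \<Omega>_def
    by (intro Bochner_Integration.integral_cong refl integral_separating_quantile_levels)
       (auto simp: cdf_unit_distribution assms)
  finally show ?thesis using that 1 by blast
qed

lemma W1_eq_cdf_distance:
  assumes "\<mu> \<in> unit_distributions" "\<nu> \<in> unit_distributions"
  shows "W1 \<mu> \<nu> = cdf_distance \<mu> \<nu>"
proof -
  obtain \<gamma> where \<gamma>: "\<gamma> \<in> couplings \<mu> \<nu>" "(\<integral>z. \<bar>fst z - snd z\<bar> \<partial>\<gamma>) = cdf_distance \<mu> \<nu>"
    using exists_optimal_coupling[OF assms] .
  have "cdf_distance \<mu> \<nu> \<le> (\<integral>z. \<bar>fst z - snd z\<bar> \<partial>\<gamma>')" if "\<gamma>' \<in> couplings \<mu> \<nu>" for \<gamma>'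
    using cdf_distance_le_expectation[of \<gamma>' fst snd] coupling_marginals[OF that assms] by simp
  then show ?thesis
    unfolding W1_def using \<gamma> by (intro cInf_eq_minimum) force+
qed

section \<open>Perturbation of the terms of the separation rate\<close>

lemma (in prob_space) expectation_le_sqrt:
  assumes [measurable]: "f \<in> borel_measurable M" and int: "integrable M (\<lambda>x. (f x)\<^sup>2 :: real)"
  shows "expectation f \<le> sqrt (expectation (\<lambda>x. (f x)\<^sup>2))"
proof (rule real_le_rsqrt)
  have "integrable M f"
    by (rule square_integrable_imp_integrable) (use int in auto)
  from variance_eq[OF this int] variance_positive[of f]
  show "(expectation f)\<^sup>2 \<le> expectation (\<lambda>x. (f x)\<^sup>2)" by simp
qed

text \<open>The inequality between the arithmetic and the geometric mean, with a free weight \<open>c\<close>.\<close>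

lemma sqrt_le_linear:
  assumes "0 \<le> v" "0 < c" "0 < m"
  shows "sqrt (v / m) \<le> c * v + 1 / (4 * c * m :: real)"
proof (rule real_le_lsqrt)
  show "0 \<le> c * v + 1 / (4 * c * m)" using assms by simp
  have "(c * v + 1 / (4 * c * m))\<^sup>2 = v / m + (c * v - 1 / (4 * c * m))\<^sup>2"
    using assms by (simp add: power2_eq_square field_simps)
  then show "v / m \<le> (c * v + 1 / (4 * c * m))\<^sup>2" by simp
qed

lemma J_functional_eq:
  assumes "\<mu> \<in> unit_distributions"
  shows "J_functional \<mu> = (\<integral>s. sqrt (cdf \<mu> s * (1 - cdf \<mu> s)) \<partial>unit_uniform)"
proof -
  note [measurable] = cdf_unit_distribution(1)[OF assms]
  show ?thesis unfolding J_functional_def by (rule integral_unit_uniform[symmetric]) measurable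
qed

lemma integrable_J_functional:
  assumes "\<mu> \<in> unit_distributions"
  shows "integrable unit_uniform (\<lambda>s. sqrt (cdf \<mu> s * (1 - cdf \<mu> s)))"
proof (rule U.integrable_const_bound)
  note [measurable] = cdf_unit_distribution(1)[OF assms]
  show "(\<lambda>s. sqrt (cdf \<mu> s * (1 - cdf \<mu> s))) \<in> borel_measurable unit_uniform" by measurable
  show "AE s in unit_uniform. norm (sqrt (cdf \<mu> s * (1 - cdf \<mu> s))) \<le> 1"
    using cdf_unit_distribution(2,3)[OF assms]
    by (intro AE_I2) (auto intro!: mult_le_one simp: abs_mult)
qed

lemma J_functional_nonneg:
  assumes "\<mu> \<in> unit_distributions"
  shows "0 \<le> J_functional \<mu>"
  unfolding J_functional_eq[OF assms] using cdf_unit_distribution(2,3)[OF assms] by simp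

lemma bernoulli_variance_lipschitz:
  fixes a b :: real
  assumes "a \<in> {0..1}" "b \<in> {0..1}"
  shows "a * (1 - a) \<le> b * (1 - b) + \<bar>a - b\<bar>"
proof -
  have "a * (1 - a) - b * (1 - b) = (a - b) * (1 - a - b)" by (simp add: algebra_simps)
  also have "\<dots> \<le> \<bar>a - b\<bar> * \<bar>1 - a - b\<bar>" by (metis abs_ge_self abs_mult)
  also have "\<dots> \<le> \<bar>a - b\<bar> * 1" using assms by (intro mult_left_mono) auto
  finally show ?thesis by simp
qed

lemma sqrt_bernoulli_variance_diff:
  fixes a b :: real
  assumes "a \<in> {0..1}" "b \<in> {0..1}"
  shows "sqrt (a * (1 - a)) \<le> sqrt (b * (1 - b)) + sqrt \<bar>a - b\<bar>"
proof -
  have "sqrt (a * (1 - a)) \<le> sqrt (b * (1 - b) + \<bar>a - b\<bar>)"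
    using bernoulli_variance_lipschitz[OF assms] by simp
  also have "\<dots> \<le> sqrt (b * (1 - b)) + sqrt \<bar>a - b\<bar>"
    using assms by (intro sqrt_add_le_add_sqrt) auto
  finally show ?thesis .
qed

text \<open>Since \<open>c\<close> may be chosen small, the change of \<open>J\<close> is paid for by a small fraction of the
  distance and a term of order \<open>1 / n\<close>.\<close>

lemma J_functional_perturbation:
  assumes "\<mu> \<in> unit_distributions" "\<nu> \<in> unit_distributions" "0 < c" "0 < (n::real)"
  shows "J_functional \<mu> / sqrt n \<le> J_functional \<nu> / sqrt n + c * cdf_distance \<mu> \<nu> + 1 / (4 * c * n)"
proof -
  note i = integrable_J_functional[OF assms(1)] integrable_J_functional[OF assms(2)]
    integrable_cdf_distance[OF assms(1,2)]
  have "J_functional \<mu> / sqrt n = (\<integral>s. sqrt (cdf \<mu> s * (1 - cdf \<mu> s)) / sqrt n \<partial>unit_uniform)"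
    by (simp add: J_functional_eq assms)
  also have "\<dots> \<le> (\<integral>s. sqrt (cdf \<nu> s * (1 - cdf \<nu> s)) / sqrt n
      + c * \<bar>cdf \<mu> s - cdf \<nu> s\<bar> + 1 / (4 * c * n) \<partial>unit_uniform)"
  proof (rule integral_mono)
    fix s
    have "sqrt (cdf \<mu> s * (1 - cdf \<mu> s)) / sqrt n
        \<le> (sqrt (cdf \<nu> s * (1 - cdf \<nu> s)) + sqrt \<bar>cdf \<mu> s - cdf \<nu> s\<bar>) / sqrt n"
      using assms by (intro divide_right_mono sqrt_bernoulli_variance_diff) (auto simp: cdf_unit_distribution)
    also have "\<dots> = sqrt (cdf \<nu> s * (1 - cdf \<nu> s)) / sqrt n + sqrt (\<bar>cdf \<mu> s - cdf \<nu> s\<bar> / n)"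
      by (simp add: add_divide_distrib real_sqrt_divide)
    also have "sqrt (\<bar>cdf \<mu> s - cdf \<nu> s\<bar> / n) \<le> c * \<bar>cdf \<mu> s - cdf \<nu> s\<bar> + 1 / (4 * c * n)"
      using assms by (intro sqrt_le_linear) auto
    finally show "sqrt (cdf \<mu> s * (1 - cdf \<mu> s)) / sqrt n
        \<le> sqrt (cdf \<nu> s * (1 - cdf \<nu> s)) / sqrt n + c * \<bar>cdf \<mu> s - cdf \<nu> s\<bar> + 1 / (4 * c * n)"
      by simp
  qed (use i in auto)
  also have "\<dots> = J_functional \<nu> / sqrt n + c * cdf_distance \<mu> \<nu> + 1 / (4 * c * n)"
    using i by (simp add: J_functional_eq assms cdf_distance_def U.prob_space[simplified])
  finally show ?thesis .
qed

lemma integrable_unit_distribution: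
  fixes f :: "real \<Rightarrow> real"
  assumes "\<pi> \<in> unit_distributions" "f \<in> borel_measurable borel" "\<And>x. x \<in> {0..1} \<Longrightarrow> \<bar>f x\<bar> \<le> B"
  shows "integrable \<pi> f"
proof -
  note u = unit_distributionsD[OF assms(1)]
  interpret prob_space \<pi> by (rule u)
  show ?thesis
  proof (rule integrable_const_bound)
    show "AE x in \<pi>. norm (f x) \<le> B"
      using u(5) by eventually_elim (simp add: assms(3))
    show "f \<in> borel_measurable \<pi>"
      using assms(2) by (simp add: u(3) cong: measurable_cong_sets)
  qed
qed

lemma bernoulli_variance_expectation_le:
  assumes "\<mu> \<in> unit_distributions" "\<nu> \<in> unit_distributions"
  shows "(\<integral>p. p * (1 - p) \<partial>\<mu>) \<le> (\<integral>p. p * (1 - p) \<partial>\<nu>) + cdf_distance \<mu> \<nu>"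
proof -
  obtain \<gamma> where \<gamma>: "\<gamma> \<in> couplings \<mu> \<nu>" "(\<integral>z. \<bar>fst z - snd z\<bar> \<partial>\<gamma>) = cdf_distance \<mu> \<nu>"
    using exists_optimal_coupling[OF assms] .
  note m = coupling_marginals[OF \<gamma>(1) assms]
  interpret \<gamma>: prob_space \<gamma> by (rule m)
  note [measurable] = m(2,3)
  have "integrable (distr \<gamma> borel fst) (\<lambda>p. p * (1 - p))" "integrable (distr \<gamma> borel snd) (\<lambda>p. p * (1 - p))"
    unfolding m(4,5) using assms
    by (auto intro!: integrable_unit_distribution[where B = 1] mult_le_one simp: abs_mult)
  then have i1: "integrable \<gamma> (\<lambda>z. fst z * (1 - fst z))" and i2: "integrable \<gamma> (\<lambda>z. snd z * (1 - snd z))"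
    by (simp_all add: integrable_distr_eq)
  have i3: "integrable \<gamma> (\<lambda>z. \<bar>fst z - snd z\<bar>)"
    using m(6,7) by (intro \<gamma>.integrable_const_bound[where B = 1]) auto
  have "(\<integral>p. p * (1 - p) \<partial>\<mu>) = (\<integral>z. fst z * (1 - fst z) \<partial>\<gamma>)"
    unfolding m(4)[symmetric] by (subst integral_distr) auto
  also have "\<dots> \<le> (\<integral>z. snd z * (1 - snd z) + \<bar>fst z - snd z\<bar> \<partial>\<gamma>)"
  proof (rule integral_mono_AE)
    show "AE z in \<gamma>. fst z * (1 - fst z) \<le> snd z * (1 - snd z) + \<bar>fst z - snd z\<bar>"
      using m(6,7) by eventually_elim (rule bernoulli_variance_lipschitz)
  qed (use i1 i2 i3 in auto)
  also have "\<dots> = (\<integral>z. snd z * (1 - snd z) \<partial>\<gamma>) + cdf_distance \<mu> \<nu>"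
    using i2 i3 \<gamma>(2) by simp
  also have "(\<integral>z. snd z * (1 - snd z) \<partial>\<gamma>) = (\<integral>p. p * (1 - p) \<partial>\<nu>)"
    unfolding m(5)[symmetric] by (subst integral_distr) auto
  finally show ?thesis .
qed

lemma bernoulli_variance_expectation_nonneg:
  assumes "\<pi> \<in> unit_distributions"
  shows "0 \<le> (\<integral>p. p * (1 - p) \<partial>\<pi>)"
proof (rule integral_nonneg_AE)
  show "AE p in \<pi>. 0 \<le> p * (1 - p)"
    using unit_distributionsD(5)[OF assms] by eventually_elim simp
qed

section \<open>Binomial mixtures\<close>

lemma sum_Bernstein_variance:
  assumes "t \<ge> 1"
  shows "(\<Sum>k\<le>t. Bernstein t k p * (real k / real t - p)\<^sup>2) = p * (1 - p) / real t"
proof -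
  have e: "Bernstein t k p * (real k - t * p)\<^sup>2
     = real k * (real k - 1) * Bernstein t k p + (1 - 2 * (t * p)) * (real k * Bernstein t k p)
       + (t * p)\<^sup>2 * Bernstein t k p" for k
    by (simp add: algebra_simps power2_eq_square)
  have s: "(\<Sum>k\<le>t. Bernstein t k p * (real k - t * p)\<^sup>2) = t * p * (1 - p)"
    unfolding e sum.distrib sum_distrib_left[symmetric] sum_k_Bernstein sum_kk_Bernstein sum_Bernstein
    by (simp add: algebra_simps power2_eq_square)
  have "(\<Sum>k\<le>t. Bernstein t k p * (real k / real t - p)\<^sup>2)
      = (\<Sum>k\<le>t. Bernstein t k p * (real k - t * p)\<^sup>2) / (real t)\<^sup>2"
    unfolding sum_divide_distrib
    using assms by (intro sum.cong refl) (simp add: field_simps power2_eq_square)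
  also have "\<dots> = p * (1 - p) / t"
    using assms unfolding s by (simp add: power2_eq_square)
  finally show ?thesis .
qed

lemma sum_Bernstein_abs_deviation:
  assumes "t \<ge> 1" "p \<in> {0..1}"
  shows "(\<Sum>k\<le>t. Bernstein t k p * \<bar>real k / real t - p\<bar>) \<le> sqrt (p * (1 - p) / real t)"
proof (rule real_le_rsqrt)
  have nn: "0 \<le> Bernstein t k p" for k using assms by (intro Bernstein_nonneg) auto
  have "(\<Sum>k\<le>t. Bernstein t k p * \<bar>real k / real t - p\<bar>)\<^sup>2
      = (\<Sum>k\<le>t. sqrt (Bernstein t k p) * (sqrt (Bernstein t k p) * \<bar>real k / real t - p\<bar>))\<^sup>2"
    using nn by (simp add: mult.assoc[symmetric])
  also have "\<dots> \<le> (\<Sum>k\<le>t. (sqrt (Bernstein t k p))\<^sup>2)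
      * (\<Sum>k\<le>t. (sqrt (Bernstein t k p) * \<bar>real k / real t - p\<bar>)\<^sup>2)"
    by (rule Cauchy_Schwarz_ineq_sum)
  also have "\<dots> = p * (1 - p) / real t"
    using nn sum_Bernstein_variance[OF assms(1)] by (simp add: power_mult_distrib)
  finally show "(\<Sum>k\<le>t. Bernstein t k p * \<bar>real k / real t - p\<bar>)\<^sup>2 \<le> p * (1 - p) / real t" .
qed

lemma binomial_mixture_weight_nonneg:
  assumes "\<pi> \<in> unit_distributions"
  shows "0 \<le> (\<integral>p. Bernstein t j p \<partial>\<pi>)"
proof (rule integral_nonneg_AE)
  show "AE p in \<pi>. 0 \<le> Bernstein t j p"
    using unit_distributionsD(5)[OF assms] by eventually_elim (simp add: Bernstein_nonneg)
qed

lemma Bernstein_le_1: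
  assumes "p \<in> {0..1}"
  shows "Bernstein t j p \<le> 1"
proof (cases "j \<le> t")
  case True
  have "Bernstein t j p \<le> (\<Sum>k\<le>t. Bernstein t k p)"
    using assms True by (intro member_le_sum) (auto intro!: Bernstein_nonneg)
  then show ?thesis by simp
qed (simp add: Bernstein_def binomial_eq_0)

lemma borel_measurable_Bernstein [measurable]: "Bernstein t j \<in> borel_measurable borel"
  unfolding Bernstein_def[abs_def] by measurable

lemma integrable_Bernstein:
  assumes "\<pi> \<in> unit_distributions"
  shows "integrable \<pi> (Bernstein t j)"
  using assms by (rule integrable_unit_distribution[where B = 1])
    (auto simp: Bernstein_le_1 Bernstein_nonneg)

lemma binomial_mixture_eq:
  "binomial_mixture t \<pi> = point_measure {0..t} (\<lambda>j. ennreal (\<integral>p. Bernstein t j p \<partial>\<pi>))"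
  by (simp add: binomial_mixture_def Bernstein_def)

lemma integral_binomial_mixture:
  fixes f :: "nat \<Rightarrow> real"
  assumes "\<pi> \<in> unit_distributions"
  shows "(\<integral>j. f j \<partial>binomial_mixture t \<pi>) = (\<Sum>j\<le>t. (\<integral>p. Bernstein t j p \<partial>\<pi>) * f j)"
  using assms unfolding binomial_mixture_eq
  by (subst lebesgue_integral_point_measure_finite)
     (auto simp: binomial_mixture_weight_nonneg atLeast0AtMost)

lemma space_binomial_mixture [simp]: "space (binomial_mixture t \<pi>) = {0..t}"
  by (simp add: binomial_mixture_def space_point_measure)

lemma sets_binomial_mixture [simp]: "sets (binomial_mixture t \<pi>) = Pow {0..t}"
  by (simp add: binomial_mixture_def sets_point_measure)

lemma prob_space_binomial_mixture:
  assumes "\<pi> \<in> unit_distributions"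
  shows "prob_space (binomial_mixture t \<pi>)"
proof (rule prob_spaceI)
  interpret prob_space \<pi> using assms by (rule unit_distributionsD)
  have "(\<Sum>j\<le>t. (\<integral>p. Bernstein t j p \<partial>\<pi>)) = (\<integral>p. (\<Sum>j\<le>t. Bernstein t j p) \<partial>\<pi>)"
    using assms by (intro Bochner_Integration.integral_sum[symmetric]) (simp add: integrable_Bernstein)
  also have "\<dots> = 1" by (simp add: prob_space)
  finally show "emeasure (binomial_mixture t \<pi>) (space (binomial_mixture t \<pi>)) = 1"
    using assms unfolding space_binomial_mixture unfolding binomial_mixture_eq
    by (subst emeasure_point_measure_finite) (auto simp: sum_ennreal binomial_mixture_weight_nonneg atLeast0AtMost)
qed

text \<open>The law of the observed proportion \<open>X / t\<close> when \<open>X\<close> has the binomial mixture distribution.\<close>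

definition proportion_distribution :: "nat \<Rightarrow> real measure \<Rightarrow> real measure" where
  "proportion_distribution t \<pi> = distr (binomial_mixture t \<pi>) borel (\<lambda>j. real j / real t)"

lemma proportion_measurable [simp]: "(\<lambda>j. real j / real t) \<in> borel_measurable (binomial_mixture t \<pi>)"
  by (simp add: binomial_mixture_def)

lemma proportion_distribution_in:
  assumes "\<pi> \<in> unit_distributions" "t \<ge> 1"
  shows "proportion_distribution t \<pi> \<in> unit_distributions"
proof (rule unit_distributionsI)
  interpret prob_space "binomial_mixture t \<pi>" using assms by (simp add: prob_space_binomial_mixture)
  show "prob_space (proportion_distribution t \<pi>)"
    unfolding proportion_distribution_def by (rule prob_space_distr) simp
  show "AE x in proportion_distribution t \<pi>. x \<in> {0..1}"
    unfolding proportion_distribution_def using assms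
    by (subst AE_distr_iff) (auto intro!: AE_I2 simp: divide_le_eq)
qed (simp add: proportion_distribution_def)

lemma cdf_proportion_distribution:
  assumes "\<pi> \<in> unit_distributions"
  shows "cdf (proportion_distribution t \<pi>) s
    = (\<Sum>j\<le>t. (\<integral>p. Bernstein t j p \<partial>\<pi>) * indicator {..s} (real j / real t))"
  unfolding proportion_distribution_def
  using assms by (simp add: cdf_distr prob_space_binomial_mixture integral_binomial_mixture)

text \<open>The bias of the plug-in estimator. Given \<open>p\<close>, the proportion \<open>j / t\<close> has mean \<open>p\<close> and
  variance \<open>p (1 - p) / t\<close>; \<open>g p s\<close> is the conditional probability given \<open>p\<close> that \<open>s\<close> separates
  \<open>j / t\<close> from \<open>p\<close>.\<close>

lemma cdf_distance_proportion_distribution: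
  assumes "\<pi> \<in> unit_distributions" "t \<ge> 1"
  shows "cdf_distance (proportion_distribution t \<pi>) \<pi> \<le> sqrt ((\<integral>p. p * (1 - p) \<partial>\<pi>) / real t)"
proof -
  note u = unit_distributionsD[OF assms(1)]
  interpret \<pi>: prob_space \<pi> by (rule u)
  interpret P: pair_prob_space \<pi> unit_uniform ..
  note [measurable_cong] = u(3)
  define g where "g p s = (\<Sum>j\<le>t. Bernstein t j p * \<bar>indicator {..s} (real j / real t) - indicator {..s} p\<bar>)"
    for p s :: real
  have g_meas [measurable]: "(\<lambda>(p, s). g p s) \<in> borel_measurable (\<pi> \<Otimes>\<^sub>M unit_uniform)"
    unfolding g_def indicator_def atMost_iff by measurable
  have g_bound: "0 \<le> g p s \<and> g p s \<le> 1" if "p \<in> {0..1}" for p s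
  proof -
    have nn: "0 \<le> Bernstein t j p" for j using that by (intro Bernstein_nonneg) auto
    have "g p s \<le> (\<Sum>j\<le>t. Bernstein t j p * 1)"
      unfolding g_def using nn by (intro sum_mono mult_left_mono) (auto simp: indicator_def)
    then show ?thesis using nn by (auto simp: g_def intro!: sum_nonneg)
  qed
  have g_int: "integrable (\<pi> \<Otimes>\<^sub>M unit_uniform) (\<lambda>(p, s). g p s)"
  proof (rule P.integrable_const_bound)
    show "AE z in \<pi> \<Otimes>\<^sub>M unit_uniform. norm (case z of (p, s) \<Rightarrow> g p s) \<le> 1"
    proof (rule P.AE_pair_measure)
      show "AE p in \<pi>. AE s in unit_uniform. norm (case (p, s) of (p, s) \<Rightarrow> g p s) \<le> 1"
        using u(5) by eventually_elim (use g_bound in auto)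
    qed measurable
  qed measurable
  have "cdf_distance (proportion_distribution t \<pi>) \<pi> \<le> (\<integral>s. (\<integral>p. g p s \<partial>\<pi>) \<partial>unit_uniform)"
    unfolding cdf_distance_def
  proof (rule integral_mono)
    show "integrable unit_uniform (\<lambda>s. \<integral>p. g p s \<partial>\<pi>)"
      using P.integrable_snd[OF g_int] .
    fix s
    have ib: "integrable \<pi> (\<lambda>p. Bernstein t j p * (indicator {..s} (real j / real t) - indicator {..s} p))" for j
      using assms(1) by (rule integrable_unit_distribution[where B = 1])
        (auto simp: abs_mult Bernstein_le_1 Bernstein_nonneg indicator_def)
    have "cdf \<pi> s = (\<integral>p. (\<Sum>j\<le>t. indicator {..s} p * Bernstein t j p) \<partial>\<pi>)"
      unfolding sum_distrib_left[symmetric] sum_Bernstein by (simp add: cdf_def u(3))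
    then have "cdf (proportion_distribution t \<pi>) s - cdf \<pi> s
       = (\<Sum>j\<le>t. (\<integral>p. Bernstein t j p \<partial>\<pi>) * indicator {..s} (real j / real t))
         - (\<integral>p. (\<Sum>j\<le>t. indicator {..s} p * Bernstein t j p) \<partial>\<pi>)"
      using assms(1) by (simp only: cdf_proportion_distribution)
    also have "(\<integral>p. (\<Sum>j\<le>t. indicator {..s} p * Bernstein t j p) \<partial>\<pi>)
       = (\<Sum>j\<le>t. \<integral>p. indicator {..s} p * Bernstein t j p \<partial>\<pi>)"
      using assms(1) by (intro Bochner_Integration.integral_sum integrable_unit_distribution[where B = 1])
        (auto simp: abs_mult Bernstein_le_1 Bernstein_nonneg indicator_def)
    also have "(\<Sum>j\<le>t. (\<integral>p. Bernstein t j p \<partial>\<pi>) * indicator {..s} (real j / real t)) - \<dots>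
       = (\<Sum>j\<le>t. \<integral>p. Bernstein t j p * (indicator {..s} (real j / real t) - indicator {..s} p) \<partial>\<pi>)"
      unfolding sum_subtractf[symmetric]
    proof (intro sum.cong refl)
      fix j
      have "integrable \<pi> (\<lambda>p. indicator {..s} p * Bernstein t j p)"
        using assms(1) by (intro integrable_unit_distribution[where B = 1])
          (auto simp: abs_mult Bernstein_le_1 Bernstein_nonneg indicator_def)
      then show "(\<integral>p. Bernstein t j p \<partial>\<pi>) * indicator {..s} (real j / real t)
           - (\<integral>p. indicator {..s} p * Bernstein t j p \<partial>\<pi>)
         = (\<integral>p. Bernstein t j p * (indicator {..s} (real j / real t) - indicator {..s} p) \<partial>\<pi>)"
        using integrable_Bernstein[OF assms(1)]
        by (simp add: right_diff_distrib mult.commute)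
    qed
    also have "\<dots> = (\<integral>p. (\<Sum>j\<le>t. Bernstein t j p * (indicator {..s} (real j / real t) - indicator {..s} p)) \<partial>\<pi>)"
      using ib by simp
    finally have "\<bar>cdf (proportion_distribution t \<pi>) s - cdf \<pi> s\<bar>
       \<le> (\<integral>p. \<bar>\<Sum>j\<le>t. Bernstein t j p * (indicator {..s} (real j / real t) - indicator {..s} p)\<bar> \<partial>\<pi>)"
      by (metis (no_types) integral_abs_bound)
    also have "\<dots> \<le> (\<integral>p. g p s \<partial>\<pi>)"
    proof (rule integral_mono_AE)
      show "integrable \<pi> (\<lambda>p. g p s)"
        using assms(1) by (rule integrable_unit_distribution[where B = 1])
          (use g_bound in \<open>auto simp: g_def indicator_def\<close>)
      show "AE p in \<pi>. \<bar>\<Sum>j\<le>t. Bernstein t j p * (indicator {..s} (real j / real t) - indicator {..s} p)\<bar> \<le> g p s"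
        using u(5)
      proof eventually_elim
        fix p :: real assume p: "p \<in> {0..1}"
        have "\<bar>\<Sum>j\<le>t. Bernstein t j p * (indicator {..s} (real j / real t) - indicator {..s} p)\<bar>
          \<le> (\<Sum>j\<le>t. \<bar>Bernstein t j p * (indicator {..s} (real j / real t) - indicator {..s} p)\<bar>)"
          by (rule sum_abs)
        also have "\<dots> = g p s"
          unfolding g_def using p by (intro sum.cong refl) (simp add: abs_mult Bernstein_nonneg)
        finally show "\<bar>\<Sum>j\<le>t. Bernstein t j p * (indicator {..s} (real j / real t) - indicator {..s} p)\<bar> \<le> g p s" .
      qed
    qed (use ib in auto)
    finally show "\<bar>cdf (proportion_distribution t \<pi>) s - cdf \<pi> s\<bar> \<le> (\<integral>p. g p s \<partial>\<pi>)" .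
  qed (use assms in \<open>intro integrable_cdf_distance proportion_distribution_in\<close>)
  also have "\<dots> = (\<integral>p. (\<integral>s. g p s \<partial>unit_uniform) \<partial>\<pi>)"
    by (rule P.Fubini_integral[OF g_int])
  also have "\<dots> \<le> (\<integral>p. sqrt (p * (1 - p) / real t) \<partial>\<pi>)"
  proof (rule integral_mono_AE)
    show "integrable \<pi> (\<lambda>p. \<integral>s. g p s \<partial>unit_uniform)"
      using P.integrable_fst[OF g_int] .
    show "integrable \<pi> (\<lambda>p. sqrt (p * (1 - p) / real t))"
      using assms(1) by (rule integrable_unit_distribution[where B = 1])
        (use assms(2) in \<open>auto simp: abs_mult divide_le_eq intro!: order.trans[OF mult_le_one]\<close>)
    show "AE p in \<pi>. (\<integral>s. g p s \<partial>unit_uniform) \<le> sqrt (p * (1 - p) / real t)"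
      using u(5)
    proof eventually_elim
      fix p :: real assume p: "p \<in> {0..1}"
      have i: "integrable unit_uniform (\<lambda>s. \<bar>indicator {..s} (real j / real t) - indicator {..s} p :: real\<bar>)" for j
      proof (rule U.integrable_const_bound[where B = 1])
        show "(\<lambda>s. \<bar>indicator {..s} (real j / real t) - indicator {..s} p :: real\<bar>) \<in> borel_measurable unit_uniform"
          unfolding indicator_def atMost_iff by measurable
      qed (auto simp: indicator_def)
      have "(\<integral>s. g p s \<partial>unit_uniform) = (\<Sum>j\<le>t. Bernstein t j p
         * (\<integral>s. \<bar>indicator {..s} (real j / real t) - indicator {..s} p\<bar> \<partial>unit_uniform))"
        unfolding g_def using i by (subst Bochner_Integration.integral_sum) auto
      also have "\<dots> = (\<Sum>j\<le>t. Bernstein t j p * \<bar>real j / real t - p\<bar>)"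
        using p assms(2)
        by (intro sum.cong refl arg_cong2[where f = "(*)"] integral_separating_levels) (auto simp: divide_le_eq)
      also have "\<dots> \<le> sqrt (p * (1 - p) / real t)"
        using p assms(2) by (rule sum_Bernstein_abs_deviation[rotated])
      finally show "(\<integral>s. g p s \<partial>unit_uniform) \<le> sqrt (p * (1 - p) / real t)" .
    qed
  qed
  also have "\<dots> \<le> sqrt (\<integral>p. (sqrt (p * (1 - p) / real t))\<^sup>2 \<partial>\<pi>)"
  proof (rule \<pi>.expectation_le_sqrt)
    show "integrable \<pi> (\<lambda>p. (sqrt (p * (1 - p) / real t))\<^sup>2)"
      using assms(1) by (rule integrable_unit_distribution[where B = 1])
        (use assms(2) in \<open>auto simp: abs_mult divide_le_eq intro!: order.trans[OF mult_le_one]\<close>)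
  qed measurable
  also have "(\<integral>p. (sqrt (p * (1 - p) / real t))\<^sup>2 \<partial>\<pi>) = (\<integral>p. p * (1 - p) / real t \<partial>\<pi>)"
  proof (rule integral_cong_AE)
    show "AE p in \<pi>. (sqrt (p * (1 - p) / real t))\<^sup>2 = p * (1 - p) / real t"
      using u(5) by eventually_elim simp
  qed measurable
  finally show ?thesis by simp
qed

section \<open>The empirical distribution of the sample\<close>

lemma space_sample_distribution: "space (sample_distribution n t \<pi>) = (\<Pi>\<^sub>E i\<in>{1..n}. {0..t})"
  by (simp add: sample_distribution_def space_PiM)

lemma finite_space_sample_distribution: "finite (space (sample_distribution n t \<pi>))"
  by (simp add: space_sample_distribution finite_PiE)

text \<open>The sample space is finite and its points are measurable, so that every function of the
  sample is a random variable.\<close>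

lemma sets_sample_distribution: "sets (sample_distribution n t \<pi>) = Pow (space (sample_distribution n t \<pi>))"
proof (intro equalityI subsetI)
  fix A assume "A \<in> Pow (space (sample_distribution n t \<pi>))"
  then have A: "A \<subseteq> (\<Pi>\<^sub>E i\<in>{1..n}. {0..t})" by (simp add: space_sample_distribution)
  have "{x} \<in> sets (sample_distribution n t \<pi>)" if "x \<in> A" for x
  proof -
    have x: "x \<in> (\<Pi>\<^sub>E i\<in>{1..n}. {0..t})" using A that by auto
    then have "(\<Pi>\<^sub>E i\<in>{1..n}. {x i}) \<in> sets (sample_distribution n t \<pi>)"
      unfolding sample_distribution_def by (intro sets_PiM_I_finite) (auto simp: PiE_iff)
    moreover have "(\<Pi>\<^sub>E i\<in>{1..n}. {x i}) = {x}"
      using x by (simp add: PiE_singleton PiE_iff)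
    ultimately show ?thesis by simp
  qed
  moreover have "finite A" using A by (rule finite_subset) (simp add: finite_PiE)
  ultimately have "(\<Union>x\<in>A. {x}) \<in> sets (sample_distribution n t \<pi>)" by (intro sets.finite_UN)
  then show "A \<in> sets (sample_distribution n t \<pi>)" by simp
qed (use sets.sets_into_space in blast)

lemma prob_space_sample_distribution:
  assumes "\<pi> \<in> unit_distributions"
  shows "prob_space (sample_distribution n t \<pi>)"
  unfolding sample_distribution_def using assms by (intro prob_space_PiM prob_space_binomial_mixture)

lemma integrable_sample_distribution:
  fixes f :: "(nat \<Rightarrow> nat) \<Rightarrow> real"
  assumes "\<pi> \<in> unit_distributions"
  shows "integrable (sample_distribution n t \<pi>) f"
proof -
  interpret prob_space "sample_distribution n t \<pi>" using assms by (rule prob_space_sample_distribution)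
  let ?S = "space (sample_distribution n t \<pi>)"
  show ?thesis
  proof (rule integrable_const_bound)
    show "AE x in sample_distribution n t \<pi>. norm (f x) \<le> Max ((\<lambda>x. norm (f x)) ` ?S)"
      by (intro AE_I2 Max_ge) (auto simp: finite_space_sample_distribution)
    show "f \<in> borel_measurable (sample_distribution n t \<pi>)"
      by (rule measurableI) (auto simp: sets_sample_distribution)
  qed
qed

lemma sample_distribution_Markov:
  fixes f :: "(nat \<Rightarrow> nat) \<Rightarrow> real"
  assumes "\<pi> \<in> unit_distributions" "\<And>x. 0 \<le> f x" "0 < c"
  shows "measure (sample_distribution n t \<pi>) {x \<in> space (sample_distribution n t \<pi>). f x \<ge> c}
    \<le> (\<integral>x. f x \<partial>sample_distribution n t \<pi>) / c"
  by (rule integral_Markov_inequality_measure[where A = "{}"])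
     (use assms in \<open>auto simp: integrable_sample_distribution\<close>)

lemma variance_sum_PiM:
  fixes g :: "'a \<Rightarrow> real"
  assumes "prob_space M" "finite I" and [measurable]: "g \<in> borel_measurable M"
    and bound: "\<And>x. \<bar>g x\<bar> \<le> B" and mean: "(\<integral>x. g x \<partial>M) = 0"
  shows "(\<integral>x. (\<Sum>i\<in>I. g (x i))\<^sup>2 \<partial>(\<Pi>\<^sub>M i\<in>I. M)) = real (card I) * (\<integral>x. (g x)\<^sup>2 \<partial>M)"
proof -
  interpret M: prob_space M by fact
  interpret product_prob_space "\<lambda>_. M" I ..
  have B: "0 \<le> B" using bound[of undefined] by linarith
  have g1: "integrable M g"
    using bound by (intro M.integrable_const_bound[where B = B]) auto
  have g2: "integrable M (\<lambda>x. (g x)\<^sup>2)"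
    using bound power_mono[OF bound abs_ge_zero, where n = 2]
    by (intro M.integrable_const_bound[where B = "B\<^sup>2"]) auto
  \<comment> \<open>\<open>g (x i) * g (x j)\<close> is written as a product over all coordinates, so that its integral factorizes\<close>
  define h where "h i j k = (if k = i \<and> k = j then (\<lambda>x. (g x)\<^sup>2) else if k = i \<or> k = j then g else (\<lambda>_. 1))"
    for i j k :: 'b
  have h_int: "integrable M (h i j k)" for i j k
    using g1 g2 by (simp add: h_def)
  have prod_h: "(\<Prod>k\<in>I. h i j k (x k)) = g (x i) * g (x j)" if "i \<in> I" "j \<in> I" for i j x
  proof (cases "i = j")
    case True
    have "(\<Prod>k\<in>I. h i j k (x k)) = (\<Prod>k\<in>{i}. h i j k (x k))"
      using that assms(2) True by (intro prod.mono_neutral_right) (auto simp: h_def)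
    then show ?thesis using True by (simp add: h_def power2_eq_square)
  next
    case False
    have "(\<Prod>k\<in>I. h i j k (x k)) = (\<Prod>k\<in>{i, j}. h i j k (x k))"
      using that assms(2) by (intro prod.mono_neutral_right) (auto simp: h_def)
    then show ?thesis using False by (simp add: h_def)
  qed
  have int: "integrable (\<Pi>\<^sub>M i\<in>I. M) (\<lambda>x. g (x i) * g (x j))" if "i \<in> I" "j \<in> I" for i j
    using product_integrable_prod[OF assms(2), of "h i j"] h_int prod_h[OF that] by simp
  have val: "(\<integral>x. g (x i) * g (x j) \<partial>(\<Pi>\<^sub>M i\<in>I. M)) = (if i = j then (\<integral>x. (g x)\<^sup>2 \<partial>M) else 0)"
    if "i \<in> I" "j \<in> I" for i j
  proof -
    have *: "(\<integral>x. g (x i) * g (x j) \<partial>(\<Pi>\<^sub>M i\<in>I. M)) = (\<Prod>k\<in>I. \<integral>x. h i j k x \<partial>M)"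
      using product_integral_prod[OF assms(2), of "h i j"] h_int prod_h[OF that] by simp
    show ?thesis
    proof (cases "i = j")
      case True
      have "(\<Prod>k\<in>I. \<integral>x. h i j k x \<partial>M) = (\<Prod>k\<in>{i}. \<integral>x. h i j k x \<partial>M)"
        using that assms(2) True by (intro prod.mono_neutral_right) (auto simp: h_def M.prob_space)
      then show ?thesis using True * by (simp add: h_def)
    next
      case False
      have "(\<Prod>k\<in>I. \<integral>x. h i j k x \<partial>M) = 0"
        using that assms(2) False mean by (intro prod_zero) (auto simp: h_def intro!: bexI[of _ i])
      then show ?thesis using False * by simp
    qed
  qed
  have "(\<integral>x. (\<Sum>i\<in>I. g (x i))\<^sup>2 \<partial>(\<Pi>\<^sub>M i\<in>I. M)) = (\<integral>x. (\<Sum>i\<in>I. \<Sum>j\<in>I. g (x i) * g (x j)) \<partial>(\<Pi>\<^sub>M i\<in>I. M))"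
    by (simp add: power2_eq_square sum_product)
  also have "\<dots> = (\<Sum>i\<in>I. \<Sum>j\<in>I. if i = j then (\<integral>x. (g x)\<^sup>2 \<partial>M) else 0)"
    using int val by (simp add: Bochner_Integration.integral_sum Bochner_Integration.integrable_sum)
  also have "\<dots> = real (card I) * (\<integral>x. (g x)\<^sup>2 \<partial>M)"
    using assms(2) by (simp add: sum.delta')
  finally show ?thesis .
qed

lemma prob_space_uniform_count_measure_interval:
  assumes "n \<ge> 1"
  shows "prob_space (uniform_count_measure {1..n::nat})"
  using assms by (intro prob_space_uniform_count_measure) auto

lemma empirical_distribution_in:
  assumes "x \<in> (\<Pi>\<^sub>E i\<in>{1..n}. {0..t})" "n \<ge> 1" "t \<ge> 1"
  shows "empirical_distribution n t x \<in> unit_distributions"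
proof (rule unit_distributionsI)
  interpret prob_space "uniform_count_measure {1..n}" using assms(2) by (rule prob_space_uniform_count_measure_interval)
  have m: "(\<lambda>i. real (x i) / real t) \<in> borel_measurable (uniform_count_measure {1..n})"
    by (simp add: uniform_count_measure_def)
  then show "prob_space (empirical_distribution n t x)"
    unfolding empirical_distribution_def by (rule prob_space_distr)
  show "AE p in empirical_distribution n t x. p \<in> {0..1}"
    unfolding empirical_distribution_def using assms m
    by (subst AE_distr_iff) (auto intro!: AE_I2 simp: divide_le_eq space_uniform_count_measure PiE_iff)
qed (simp add: empirical_distribution_def)

lemma cdf_empirical_distribution:
  assumes "n \<ge> 1"
  shows "cdf (empirical_distribution n t x) s = (\<Sum>i=1..n. indicator {..s} (real (x i) / real t)) / real n"
  unfolding empirical_distribution_def using assms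
  by (subst cdf_distr[OF prob_space_uniform_count_measure_interval])
     (auto simp: uniform_count_measure_def[symmetric] integral_uniform_count_measure
       cong: measurable_cong_sets)

text \<open>The stochastic error of the plug-in estimator. At each level \<open>s\<close> the empirical distribution
  function is an average of \<open>n\<close> independent indicators with mean \<open>F s\<close>, so its mean absolute error
  is at most its standard deviation \<open>sqrt (F s * (1 - F s) / n)\<close>.\<close>

lemma expected_cdf_distance_empirical_proportion:
  assumes "\<pi> \<in> unit_distributions" "n \<ge> 1" "t \<ge> 1"
  shows "(\<integral>x. cdf_distance (empirical_distribution n t x) (proportion_distribution t \<pi>) \<partial>sample_distribution n t \<pi>)
    \<le> J_functional (proportion_distribution t \<pi>) / sqrt (real n)"
proof -
  let ?S = "sample_distribution n t \<pi>" and ?M = "binomial_mixture t \<pi>"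
  define F where "F = cdf (proportion_distribution t \<pi>)"
  note pd = proportion_distribution_in[OF assms(1,3)]
  have F: "0 \<le> F s" "F s \<le> 1" for s
    using cdf_unit_distribution[OF pd] by (auto simp: F_def)
  have [measurable]: "F \<in> borel_measurable borel"
    using cdf_unit_distribution[OF pd] by (simp add: F_def)
  interpret M: prob_space ?M using assms by (simp add: prob_space_binomial_mixture)
  interpret S: prob_space ?S using assms by (simp add: prob_space_sample_distribution)
  interpret P: pair_prob_space ?S unit_uniform ..
  define g where "g s j = indicator {..s} (real j / real t) - F s" for s and j :: nat
  have g_bound: "\<bar>g s j\<bar> \<le> 1" for s j
    using F[of s] by (auto simp: g_def indicator_def)
  have diff: "cdf (empirical_distribution n t x) s - F s = (\<Sum>i=1..n. g s (x i)) / real n" for x s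
    using assms by (simp add: cdf_empirical_distribution g_def sum_subtractf diff_divide_distrib)
  have [measurable]: "(\<lambda>x. real (x i)) \<in> borel_measurable ?S" for i
    by (rule borel_measurable_integrable) (simp add: integrable_sample_distribution assms)
  have meas: "(\<lambda>(x, s). \<bar>(\<Sum>i=1..n. g s (x i)) / real n\<bar>) \<in> borel_measurable (?S \<Otimes>\<^sub>M unit_uniform)"
    unfolding g_def indicator_def atMost_iff by measurable
  have bound: "\<bar>(\<Sum>i=1..n. g s (x i)) / real n\<bar> \<le> 1" for s x
  proof -
    have "\<bar>\<Sum>i=1..n. g s (x i)\<bar> \<le> (\<Sum>i=1..n. 1)"
      by (rule order.trans[OF sum_abs]) (intro sum_mono g_bound)
    then show ?thesis using assms by (simp add: divide_le_eq abs_mult)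
  qed
  have int: "integrable (?S \<Otimes>\<^sub>M unit_uniform) (\<lambda>(x, s). \<bar>(\<Sum>i=1..n. g s (x i)) / real n\<bar>)"
    using meas bound by (intro P.integrable_const_bound[where B = 1]) (auto simp del: abs_divide)
  have pointwise: "(\<integral>x. \<bar>(\<Sum>i=1..n. g s (x i)) / real n\<bar> \<partial>?S) \<le> sqrt (F s * (1 - F s)) / sqrt (real n)" for s
  proof -
    have ind: "(\<integral>j. indicator {..s} (real j / real t) \<partial>?M) = F s"
      using assms unfolding F_def proportion_distribution_def
      by (subst cdf_distr) (auto simp: M.prob_space_axioms)
    have i: "integrable ?M f" for f :: "nat \<Rightarrow> real"
      using integrable_point_measure_finite unfolding binomial_mixture_eq
      by (metis finite_atLeastAtMost)
    have mean: "(\<integral>j. g s j \<partial>?M) = 0"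
      unfolding g_def using i by (simp add: ind M.prob_space[simplified])
    have "(\<integral>j. (g s j)\<^sup>2 \<partial>?M) = (\<integral>j. (1 - 2 * F s) * indicator {..s} (real j / real t) + (F s)\<^sup>2 \<partial>?M)"
      by (intro Bochner_Integration.integral_cong refl)
         (auto simp: g_def indicator_def power2_eq_square algebra_simps)
    also have "\<dots> = F s * (1 - F s)"
      using i by (simp add: ind M.prob_space[simplified] power2_eq_square algebra_simps)
    finally have var: "(\<integral>j. (g s j)\<^sup>2 \<partial>?M) = F s * (1 - F s)" .
    have "(\<integral>x. \<bar>(\<Sum>i=1..n. g s (x i)) / real n\<bar> \<partial>?S)
        \<le> sqrt (\<integral>x. \<bar>(\<Sum>i=1..n. g s (x i)) / real n\<bar>\<^sup>2 \<partial>?S)"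
      using assms by (intro S.expectation_le_sqrt borel_measurable_integrable) (auto intro: integrable_sample_distribution)
    also have "(\<integral>x. \<bar>(\<Sum>i=1..n. g s (x i)) / real n\<bar>\<^sup>2 \<partial>?S) = (\<integral>x. (\<Sum>i=1..n. g s (x i))\<^sup>2 \<partial>?S) / (real n)\<^sup>2"
      by (simp add: power_divide)
    also have "(\<integral>x. (\<Sum>i=1..n. g s (x i))\<^sup>2 \<partial>?S) = real n * (F s * (1 - F s))"
      unfolding sample_distribution_def
      using variance_sum_PiM[OF M.prob_space_axioms _ _ g_bound mean, of "{1..n}"] i[THEN borel_measurable_integrable]
      by (simp add: var)
    also have "sqrt (real n * (F s * (1 - F s)) / (real n)\<^sup>2) = sqrt (F s * (1 - F s) / real n)"
      using assms by (simp add: power2_eq_square)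
    finally show ?thesis by (simp add: real_sqrt_divide)
  qed
  have "(\<integral>x. cdf_distance (empirical_distribution n t x) (proportion_distribution t \<pi>) \<partial>?S)
      = (\<integral>x. (\<integral>s. \<bar>(\<Sum>i=1..n. g s (x i)) / real n\<bar> \<partial>unit_uniform) \<partial>?S)"
    unfolding cdf_distance_def F_def[symmetric] diff ..
  also have "\<dots> = (\<integral>s. (\<integral>x. \<bar>(\<Sum>i=1..n. g s (x i)) / real n\<bar> \<partial>?S) \<partial>unit_uniform)"
    by (rule P.Fubini_integral[OF int, symmetric])
  also have "\<dots> \<le> (\<integral>s. sqrt (F s * (1 - F s)) / sqrt (real n) \<partial>unit_uniform)"
    using P.integrable_snd[OF int] integrable_J_functional[OF pd] pointwise
    by (intro integral_mono) (auto simp: F_def)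
  also have "\<dots> = J_functional (proportion_distribution t \<pi>) / sqrt (real n)"
    by (simp add: J_functional_eq[OF pd] F_def)
  finally show ?thesis .
qed

lemma expected_cdf_distance_empirical:
  assumes "\<pi> \<in> unit_distributions" "n \<ge> 1" "t \<ge> 1"
  shows "(\<integral>x. cdf_distance (empirical_distribution n t x) \<pi> \<partial>sample_distribution n t \<pi>)
    \<le> J_functional \<pi> / sqrt (real n) + 2 * sqrt ((\<integral>p. p * (1 - p) \<partial>\<pi>) / real t) + 1 / (4 * real n)"
proof -
  let ?S = "sample_distribution n t \<pi>" and ?\<mu> = "proportion_distribution t \<pi>"
  interpret S: prob_space ?S using assms by (simp add: prob_space_sample_distribution)
  note pd = proportion_distribution_in[OF assms(1,3)]
  note i = integrable_sample_distribution[OF assms(1)]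
  have "(\<integral>x. cdf_distance (empirical_distribution n t x) \<pi> \<partial>?S)
      \<le> (\<integral>x. cdf_distance (empirical_distribution n t x) ?\<mu> + cdf_distance ?\<mu> \<pi> \<partial>?S)"
  proof (rule integral_mono[OF i i])
    fix x assume "x \<in> space ?S"
    then show "cdf_distance (empirical_distribution n t x) \<pi>
        \<le> cdf_distance (empirical_distribution n t x) ?\<mu> + cdf_distance ?\<mu> \<pi>"
      using assms pd by (intro cdf_distance_triangle empirical_distribution_in) (auto simp: space_sample_distribution)
  qed
  also have "\<dots> = (\<integral>x. cdf_distance (empirical_distribution n t x) ?\<mu> \<partial>?S) + cdf_distance ?\<mu> \<pi>"
    using i by (simp add: S.prob_space)
  also have "\<dots> \<le> J_functional ?\<mu> / sqrt (real n) + cdf_distance ?\<mu> \<pi>"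
    using expected_cdf_distance_empirical_proportion[OF assms] by simp
  \<comment> \<open>perturbation with weight \<open>c = 1\<close>: it costs a second copy of the bias\<close>
  also have "J_functional ?\<mu> / sqrt (real n)
      \<le> J_functional \<pi> / sqrt (real n) + 1 * cdf_distance ?\<mu> \<pi> + 1 / (4 * 1 * real n)"
    using assms by (intro J_functional_perturbation pd) auto
  finally show ?thesis
    using cdf_distance_proportion_distribution[OF assms(1,3)] by simp
qed

section \<open>Upper quantiles on a finite probability space\<close>

context
  fixes M :: "'a measure" and T :: "'a \<Rightarrow> real" and \<alpha> :: real
  assumes M: "prob_space M" "finite (space M)" "sets M = Pow (space M)"
    and \<alpha>: "0 < \<alpha>" "\<alpha> < 1"
begin

lemma Min_le_upper_tail_level:
  assumes "measure M {x \<in> space M. T x > u} \<le> \<alpha>"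
  shows "Min (T ` space M) \<le> u"
proof (rule ccontr)
  interpret prob_space M by (rule M)
  assume "\<not> Min (T ` space M) \<le> u"
  then have "u < T x" if "x \<in> space M" for x
    using Min_le[OF finite_imageI[OF M(2)] imageI[OF that], of T] by linarith
  then have "{x \<in> space M. T x > u} = space M" by auto
  then show False using assms \<alpha> prob_space by simp
qed

lemma quantile_le:
  assumes "measure M {x \<in> space M. T x > u} \<le> \<alpha>"
  shows "Inf {u. measure M {x \<in> space M. T x > u} \<le> \<alpha>} \<le> u"
  using assms by (intro cInf_lower bdd_belowI[of _ "Min (T ` space M)"]) (auto intro: Min_le_upper_tail_level)

text \<open>The infimum \<open>q\<close> is itself an admissible level: \<open>T\<close> takes finitely many values, so no value
  lies strictly between \<open>q\<close> and some \<open>r > q\<close>, and all levels in between have the same upper tail.\<close>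

lemma upper_tail_quantile_le:
  defines "q \<equiv> Inf {u. measure M {x \<in> space M. T x > u} \<le> \<alpha>}"
  shows "measure M {x \<in> space M. T x > q} \<le> \<alpha>"
proof -
  interpret prob_space M by (rule M)
  let ?Q = "{u. measure M {x \<in> space M. T x > u} \<le> \<alpha>}"
  have "{x \<in> space M. T x > Max (T ` space M)} = {}"
    using M(2) by (auto simp: not_less)
  then have "measure M {x \<in> space M. T x > Max (T ` space M)} = 0"
    by (simp only: measure_empty)
  then have "Max (T ` space M) \<in> ?Q" using \<alpha> by simp
  then have ne: "?Q \<noteq> {}" by blast
  let ?V = "{v \<in> T ` space M. q < v}"
  obtain r where r: "q < r" "\<And>v. v \<in> ?V \<Longrightarrow> r \<le> v"
  proof (cases "?V = {}")
    case True
    then show ?thesis using that[of "q + 1"] by auto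
  next
    case False
    have "finite ?V" using M(2) by simp
    then show ?thesis using that[of "Min ?V"] False by auto
  qed
  obtain u where u: "u \<in> ?Q" "u < r"
    using cInf_lessD[OF ne, of r] r(1) unfolding q_def by blast
  have "{x \<in> space M. T x > q} \<subseteq> {x \<in> space M. T x > u}"
    using r(2) u(2) by force
  then have "measure M {x \<in> space M. T x > q} \<le> measure M {x \<in> space M. T x > u}"
    by (rule finite_measure_mono) (auto simp: M(3))
  then show ?thesis using u(1) by simp
qed

end

section \<open>Level and power of the plug-in test\<close>

lemma W1_hat_eq:
  assumes "\<pi>\<^sub>0 \<in> unit_distributions" "n \<ge> 1" "t \<ge> 1" "x \<in> space (sample_distribution n t \<pi>)"
  shows "W1_hat n t \<pi>\<^sub>0 x = cdf_distance (empirical_distribution n t x) \<pi>\<^sub>0"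
  using assms unfolding W1_hat_def
  by (intro W1_eq_cdf_distance empirical_distribution_in) (auto simp: space_sample_distribution)

lemma plugin_test_level:
  assumes "0 < \<alpha>" "\<alpha> < 1" "\<pi>\<^sub>0 \<in> unit_distributions"
  shows "measure (sample_distribution n t \<pi>\<^sub>0)
    {x \<in> space (sample_distribution n t \<pi>\<^sub>0). plugin_test \<alpha> n t \<pi>\<^sub>0 x = 1} \<le> \<alpha>"
proof -
  have "{x \<in> space (sample_distribution n t \<pi>\<^sub>0). plugin_test \<alpha> n t \<pi>\<^sub>0 x = 1}
    = {x \<in> space (sample_distribution n t \<pi>\<^sub>0).
        W1_hat n t \<pi>\<^sub>0 x > null_quantile \<alpha> n t \<pi>\<^sub>0 (W1_hat n t \<pi>\<^sub>0)}"
    by (auto simp: plugin_test_def)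
  then show ?thesis
    unfolding null_quantile_def
    using upper_tail_quantile_le[OF prob_space_sample_distribution finite_space_sample_distribution
        sets_sample_distribution assms(1,2)] assms(3) by simp
qed

text \<open>The separation rate of the test, without its constant factor.\<close>

definition separation_rate :: "nat \<Rightarrow> nat \<Rightarrow> real measure \<Rightarrow> real" where
  "separation_rate n t \<pi> = J_functional \<pi> / sqrt (real n)
    + sqrt ((\<integral>p. p * (1 - p) \<partial>\<pi>) / real t) + 1 / real n + 1 / real t"

lemma separation_rate_pos:
  assumes "\<pi> \<in> unit_distributions" "n \<ge> 1" "t \<ge> 1"
  shows "0 < separation_rate n t \<pi>"
  unfolding separation_rate_def
  using assms J_functional_nonneg[OF assms(1)] bernoulli_variance_expectation_nonneg[OF assms(1)]
  by (intro add_nonneg_pos add_nonneg_nonneg) auto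

lemma expected_cdf_distance_le_separation_rate:
  assumes "\<pi> \<in> unit_distributions" "n \<ge> 1" "t \<ge> 1"
  shows "(\<integral>x. cdf_distance (empirical_distribution n t x) \<pi> \<partial>sample_distribution n t \<pi>)
    \<le> 2 * separation_rate n t \<pi>"
proof -
  have "0 \<le> J_functional \<pi> / sqrt (real n)" "1 / (4 * real n) \<le> 2 * (1 / real n)" "0 \<le> 1 / real t"
    using J_functional_nonneg[OF assms(1)] assms by (auto simp: field_simps)
  then show ?thesis
    using expected_cdf_distance_empirical[OF assms] unfolding separation_rate_def distrib_left by linarith
qed

text \<open>The expected error under \<open>\<pi>\<close> in terms of the separation rate at \<open>\<pi>\<^sub>0\<close>. Both
  terms of \<open>expected_cdf_distance_empirical\<close> that depend on \<open>\<pi>\<close> are moved to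
  \<open>\<pi>\<^sub>0\<close>; for small \<open>c\<close> the price is a small fraction of the distance of the two
  distributions.\<close>

lemma expected_cdf_distance_alternative:
  assumes "\<pi> \<in> unit_distributions" "\<pi>\<^sub>0 \<in> unit_distributions" "n \<ge> 1" "t \<ge> 1" "0 < c"
  shows "(\<integral>x. cdf_distance (empirical_distribution n t x) \<pi> \<partial>sample_distribution n t \<pi>)
    \<le> (2 + 1 / (2 * c)) * separation_rate n t \<pi>\<^sub>0 + 3 * c * cdf_distance \<pi> \<pi>\<^sub>0"
proof -
  let ?w = "cdf_distance \<pi> \<pi>\<^sub>0"
  define e where "e \<pi> = (\<integral>p. p * (1 - p) \<partial>\<pi>)" for \<pi> :: "real measure"
  have e0: "0 \<le> e \<pi>\<^sub>0" unfolding e_def by (rule bernoulli_variance_expectation_nonneg[OF assms(2)])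
  have J: "J_functional \<pi> / sqrt (real n)
      \<le> J_functional \<pi>\<^sub>0 / sqrt (real n) + c * ?w + 1 / (4 * c * real n)"
    using assms by (intro J_functional_perturbation) auto
  have "sqrt (e \<pi> / real t) \<le> sqrt (e \<pi>\<^sub>0 / real t + ?w / real t)"
    using bernoulli_variance_expectation_le[OF assms(1,2)] assms(4)
    by (simp add: e_def add_divide_distrib[symmetric] divide_right_mono)
  also have "\<dots> \<le> sqrt (e \<pi>\<^sub>0 / real t) + sqrt (?w / real t)"
    using e0 by (intro sqrt_add_le_add_sqrt) (auto simp: cdf_distance_nonneg)
  also have "sqrt (?w / real t) \<le> c * ?w + 1 / (4 * c * real t)"
    using assms by (intro sqrt_le_linear) (auto simp: cdf_distance_nonneg)
  finally have V: "sqrt (e \<pi> / real t) \<le> sqrt (e \<pi>\<^sub>0 / real t) + (c * ?w + 1 / (4 * c * real t))"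
    by simp
  \<comment> \<open>with nonnegative names for the terms, the last step is linear apart from products with \<open>k\<close>\<close>
  define j v r s k where "j = J_functional \<pi>\<^sub>0 / sqrt (real n)" and "v = sqrt (e \<pi>\<^sub>0 / real t)"
    and "r = 1 / real n" and "s = 1 / real t" and "k = 1 / (4 * c)"
  have nn: "0 \<le> j" "0 \<le> v" "0 \<le> r" "0 \<le> s" "0 \<le> k"
    using J_functional_nonneg[OF assms(2)] assms(5) e0 by (auto simp: j_def v_def r_def s_def k_def)
  have "(\<integral>x. cdf_distance (empirical_distribution n t x) \<pi> \<partial>sample_distribution n t \<pi>)
      \<le> (j + c * ?w + k * r) + 2 * (v + (c * ?w + k * s)) + 1 / 4 * r"
    using expected_cdf_distance_empirical[OF assms(1,3,4)] J V
    by (simp add: e_def j_def v_def r_def s_def k_def)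
  also have "\<dots> \<le> (2 + 2 * k) * (j + v + r + s) + 3 * c * ?w"
    using nn mult_nonneg_nonneg[of k j] mult_nonneg_nonneg[of k v] mult_nonneg_nonneg[of k r]
    by (simp add: algebra_simps)
  finally show ?thesis
    by (simp add: separation_rate_def e_def j_def v_def r_def s_def k_def)
qed

text \<open>Markov's inequality at the level where its bound equals \<open>\<alpha>\<close>.\<close>

lemma null_quantile_le:
  assumes "0 < \<alpha>" "\<alpha> < 1" "\<pi>\<^sub>0 \<in> unit_distributions" "n \<ge> 1" "t \<ge> 1"
  shows "null_quantile \<alpha> n t \<pi>\<^sub>0 (W1_hat n t \<pi>\<^sub>0) \<le> 2 * separation_rate n t \<pi>\<^sub>0 / \<alpha>"
proof -
  let ?S = "sample_distribution n t \<pi>\<^sub>0" and ?d = "\<lambda>x. cdf_distance (empirical_distribution n t x) \<pi>\<^sub>0"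
  let ?u = "2 * separation_rate n t \<pi>\<^sub>0 / \<alpha>"
  interpret S: prob_space ?S using assms by (simp add: prob_space_sample_distribution)
  have u: "0 < ?u" using assms separation_rate_pos[of \<pi>\<^sub>0 n t] by simp
  have "measure ?S {x \<in> space ?S. W1_hat n t \<pi>\<^sub>0 x > ?u} \<le> measure ?S {x \<in> space ?S. ?d x \<ge> ?u}"
    using assms W1_hat_eq[of \<pi>\<^sub>0 n t _ \<pi>\<^sub>0]
    by (intro S.finite_measure_mono) (auto simp: sets_sample_distribution)
  also have "\<dots> \<le> (\<integral>x. ?d x \<partial>?S) / ?u"
    using assms u by (intro sample_distribution_Markov) (auto simp: cdf_distance_nonneg)
  also have "\<dots> \<le> 2 * separation_rate n t \<pi>\<^sub>0 / ?u"
    using assms u expected_cdf_distance_le_separation_rate[of \<pi>\<^sub>0 n t] by (intro divide_right_mono) auto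
  also have "\<dots> = \<alpha>" using separation_rate_pos[OF assms(3-5)] assms(1) by simp
  finally show ?thesis
    unfolding null_quantile_def using assms
    by (intro quantile_le[OF prob_space_sample_distribution finite_space_sample_distribution sets_sample_distribution])
qed

text \<open>The first summand of the constant puts the quantile below half of the distance \<open>w\<close> between
  \<open>\<pi>\<close> and \<open>\<pi>\<^sub>0\<close>. By the triangle inequality an accepted sample has an empirical distribution at
  distance at least \<open>w / 2\<close> from \<open>\<pi>\<close>. The second summand, with weight \<open>c = \<beta> / 12\<close> in
  \<open>expected_cdf_distance_alternative\<close>, bounds the expectation of that distance by \<open>\<beta> w / 2\<close>.\<close>

lemma plugin_test_type_II:
  fixes \<alpha> \<beta> :: real
  assumes "0 < \<alpha>" "\<alpha> < 1" "0 < \<beta>"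
    and "\<pi> \<in> unit_distributions" "\<pi>\<^sub>0 \<in> unit_distributions" "n \<ge> 1" "t \<ge> 1"
    and sep: "W1 \<pi> \<pi>\<^sub>0 \<ge> (4 / \<alpha> + (8 + 24 / \<beta>) / \<beta>) * separation_rate n t \<pi>\<^sub>0"
  shows "measure (sample_distribution n t \<pi>)
    {x \<in> space (sample_distribution n t \<pi>). plugin_test \<alpha> n t \<pi>\<^sub>0 x = 0} \<le> \<beta>"
proof -
  let ?S = "sample_distribution n t \<pi>" and ?R = "separation_rate n t \<pi>\<^sub>0"
  let ?d = "\<lambda>x. cdf_distance (empirical_distribution n t x) \<pi>"
  define w where "w = cdf_distance \<pi> \<pi>\<^sub>0"
  interpret S: prob_space ?S using assms by (simp add: prob_space_sample_distribution)
  have R: "0 < ?R" using assms by (intro separation_rate_pos)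
  have w: "(4 / \<alpha> + (8 + 24 / \<beta>) / \<beta>) * ?R \<le> w"
    using sep assms by (simp add: w_def W1_eq_cdf_distance)
  have p1: "0 < (4 / \<alpha>) * ?R" and p2: "0 < ((8 + 24 / \<beta>) / \<beta>) * ?R"
    using assms R by (auto intro!: mult_pos_pos divide_pos_pos add_pos_pos)
  have w1: "(4 / \<alpha>) * ?R \<le> w" and w2: "((8 + 24 / \<beta>) / \<beta>) * ?R \<le> w" and w0: "0 < w"
    using w p1 p2 by (simp_all only: distrib_right)
  have "null_quantile \<alpha> n t \<pi>\<^sub>0 (W1_hat n t \<pi>\<^sub>0) \<le> 2 * ?R / \<alpha>"
    using assms by (intro null_quantile_le)
  also have "\<dots> \<le> w / 2" using w1 by simp
  finally have q: "null_quantile \<alpha> n t \<pi>\<^sub>0 (W1_hat n t \<pi>\<^sub>0) \<le> w / 2" .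
  have "{x \<in> space ?S. plugin_test \<alpha> n t \<pi>\<^sub>0 x = 0} \<subseteq> {x \<in> space ?S. ?d x \<ge> w / 2}"
  proof (intro subsetI CollectI conjI)
    fix x assume x: "x \<in> {x \<in> space ?S. plugin_test \<alpha> n t \<pi>\<^sub>0 x = 0}"
    then show "x \<in> space ?S" by simp
    have emp: "empirical_distribution n t x \<in> unit_distributions"
      using x assms by (intro empirical_distribution_in) (auto simp: space_sample_distribution)
    have "cdf_distance (empirical_distribution n t x) \<pi>\<^sub>0 \<le> w / 2"
      using x q W1_hat_eq[of \<pi>\<^sub>0 n t x \<pi>] assms by (auto simp: plugin_test_def not_less)
    moreover have "w \<le> ?d x + cdf_distance (empirical_distribution n t x) \<pi>\<^sub>0"
      unfolding w_def cdf_distance_commute[of "empirical_distribution n t x" \<pi>]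
      using assms emp by (intro cdf_distance_triangle)
    ultimately show "?d x \<ge> w / 2" by linarith
  qed
  then have "measure ?S {x \<in> space ?S. plugin_test \<alpha> n t \<pi>\<^sub>0 x = 0} \<le> measure ?S {x \<in> space ?S. ?d x \<ge> w / 2}"
    by (rule S.finite_measure_mono) (auto simp: sets_sample_distribution)
  also have "\<dots> \<le> (\<integral>x. ?d x \<partial>?S) / (w / 2)"
    using assms w0 by (intro sample_distribution_Markov) (auto simp: cdf_distance_nonneg)
  also have "\<dots> \<le> \<beta>"
  proof -
    have "(\<integral>x. ?d x \<partial>?S) \<le> (2 + 1 / (2 * (\<beta> / 12))) * ?R + 3 * (\<beta> / 12) * w"
      unfolding w_def using assms by (intro expected_cdf_distance_alternative) auto
    also have "(2 + 1 / (2 * (\<beta> / 12))) * ?R = \<beta> / 4 * (((8 + 24 / \<beta>) / \<beta>) * ?R)"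
      using assms by (simp add: field_simps)
    also have "\<dots> \<le> \<beta> / 4 * w" using w2 assms by (intro mult_left_mono) auto
    finally show ?thesis using w0 by (simp add: divide_le_eq)
  qed
  finally show ?thesis .
qed

theorem theorem1:
  fixes \<alpha> \<beta> :: real
  assumes "0 < \<alpha>" and "\<alpha> < 1" and "0 < \<beta>" and "\<beta> < 1 - \<alpha>"
  shows "(\<forall>(n::nat) (t::nat). \<forall>\<pi>\<^sub>0\<in>unit_distributions. n \<ge> 1 \<longrightarrow> t \<ge> 1 \<longrightarrow>
            measure (sample_distribution n t \<pi>\<^sub>0)
              {x \<in> space (sample_distribution n t \<pi>\<^sub>0). plugin_test \<alpha> n t \<pi>\<^sub>0 x = 1} \<le> \<alpha>) \<and>
         (\<exists>C>0. \<forall>(n::nat) (t::nat) (\<epsilon>::real). \<forall>\<pi>\<^sub>0\<in>unit_distributions. n \<ge> 1 \<longrightarrow> t \<ge> 1 \<longrightarrow>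
            \<epsilon> \<ge> C * (J_functional \<pi>\<^sub>0 / sqrt (real n)
                     + sqrt ((\<integral>p. p * (1 - p) \<partial>\<pi>\<^sub>0) / real t)
                     + 1 / real n + 1 / real t) \<longrightarrow>
            (SUP \<pi>\<in>{\<pi>\<in>unit_distributions. W1 \<pi> \<pi>\<^sub>0 \<ge> \<epsilon>}.
               emeasure (sample_distribution n t \<pi>)
                 {x \<in> space (sample_distribution n t \<pi>). plugin_test \<alpha> n t \<pi>\<^sub>0 x = 0}) \<le> ennreal \<beta>)"
proof (intro conjI allI ballI impI exI[of _ "4 / \<alpha> + (8 + 24 / \<beta>) / \<beta>"] SUP_least)
  fix n t :: nat and \<pi>\<^sub>0 assume "\<pi>\<^sub>0 \<in> unit_distributions"
  then show "measure (sample_distribution n t \<pi>\<^sub>0)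
      {x \<in> space (sample_distribution n t \<pi>\<^sub>0). plugin_test \<alpha> n t \<pi>\<^sub>0 x = 1} \<le> \<alpha>"
    using assms by (intro plugin_test_level)
next
  show "0 < 4 / \<alpha> + (8 + 24 / \<beta>) / \<beta>"
    using assms by (intro add_pos_pos divide_pos_pos) auto
next
  fix n t :: nat and \<epsilon> :: real and \<pi>\<^sub>0 \<pi>
  assume *: "\<pi>\<^sub>0 \<in> unit_distributions" "n \<ge> 1" "t \<ge> 1"
    "(4 / \<alpha> + (8 + 24 / \<beta>) / \<beta>) * (J_functional \<pi>\<^sub>0 / sqrt (real n)
       + sqrt ((\<integral>p. p * (1 - p) \<partial>\<pi>\<^sub>0) / real t) + 1 / real n + 1 / real t) \<le> \<epsilon>"
    "\<pi> \<in> {\<pi> \<in> unit_distributions. W1 \<pi> \<pi>\<^sub>0 \<ge> \<epsilon>}"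
  interpret prob_space "sample_distribution n t \<pi>"
    using * by (simp add: prob_space_sample_distribution)
  show "emeasure (sample_distribution n t \<pi>)
      {x \<in> space (sample_distribution n t \<pi>). plugin_test \<alpha> n t \<pi>\<^sub>0 x = 0} \<le> ennreal \<beta>"
    unfolding emeasure_eq_measure using * assms
    by (intro ennreal_leI plugin_test_type_II) (auto simp: separation_rate_def)
qed

end
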